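(* Put $A(p)=\int_0^1\arctan^p(x)\,dx$ for $p\in\mathbb{N}$ and $t(\bar1)=\sum_{n\ge1}\frac{(-1)^n}{2n-1}=-\frac{\pi}{4}$; $t^{j}(\bar 1)$ denotes the $j$-th power $(t(\bar1))^j$. For all positive integers $n$ and $m$: \begin{align*} \int_0^1 x^{2n-2}\arctan^{2m}(x)\,dx={}&\frac{1+(-1)^n}{2n-1}t^{2m}(\bar 1)+\frac{(-1)^{n+m}(2m)!}{2^{2m}(2n-1)}T_n^{\{1\}_{2m-1},-1}\\ &-\frac{(-1)^{n}(2m)!}{2n-1}\sum_{u=0}^{m-1}\frac{(-1)^uT_n^{\{1\}_{2u}}}{(2m-2u)!\,2^{2u}}A(2m-2u)\\ &+\frac{(-1)^{n}(2m)!}{2n-1}\sum_{v=1}^{m-1}\frac{(-1)^{v}t^{2m-2v}(\bar 1)}{2^{2v}(2m-2v)!}\left(T_n^{\{1\}_{2v}}+T_n^{\{1\}_{2v-1},-1}\right)\\ &+\frac{(-1)^{n}(2m)!}{2n-1}\sum_{v=0}^{m-1}\frac{(-1)^{v}t^{2m-2v-1}(\bar 1)}{2^{2v+1}(2m-2v-1)!}\left(S_n^{\{1\}_{2v+1}}-S_n^{\{1\}_{2v},-1}\right), \end{align*} \begin{align*} \int_0^1 x^{2n-2}\arctan^{2m-1}(x)\,dx={}&-\frac{1+(-1)^n}{2n-1}t^{2m-1}(\bar 1)-\frac{(-1)^{n+m}(2m-1)!}{2^{2m-1}(2n-1)}S_n^{\{1\}_{2m-2},-1}\\ &-\frac{(-1)^{n}(2m-1)!}{2n-1}\sum_{u=0}^{m-1}\frac{(-1)^uT_n^{\{1\}_{2u}}}{(2m-2u-1)!\,2^{2u}}A(2m-2u-1)\\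 &+\frac{(-1)^{n}(2m-1)!}{2n-1}\sum_{v=1}^{m-1}\frac{(-1)^{v+1}t^{2m-2v-1}(\bar 1)}{2^{2v}(2m-2v-1)!}\left(T_n^{\{1\}_{2v}}+T_n^{\{1\}_{2v-1},-1}\right)\\ &+\frac{(-1)^{n}(2m-1)!}{2n-1}\sum_{v=1}^{m-1}\frac{(-1)^{v}t^{2m-2v}(\bar 1)}{2^{2v-1}(2m-2v)!}\left(S_n^{\{1\}_{2v-1}}-S_n^{\{1\}_{2v-2},-1}\right), \end{align*} \begin{align*} \int_0^1 x^{2n-1}\arctan^{2m}(x)\,dx={}&\frac{1-(-1)^n}{2n}t^{2m}(\bar 1)+\frac{(-1)^{n+m}(2m)!}{2^{2m}(2n)}S_{n}^{\{1\}_{2m-1},-1}\\ &+\frac{(-1)^{n}(2m)!}{2n}\sum_{u=0}^{m-1}\frac{(-1)^uT_{n}^{\{1\}_{2u+1}}}{(2m-2u-1)!\,2^{2u+1}}A(2m-2u-1)\\ &+\frac{(-1)^{n}(2m)!}{2n}\sum_{v=0}^{m-1}\frac{(-1)^{v}t^{2m-2v-1}(\bar 1)}{2^{2v+1}(2m-2v-1)!}\left(T_{n}^{\{1\}_{2v+1}}+T_{n}^{\{1\}_{2v},-1}\right)\\ &+\frac{(-1)^{n}(2m)!}{2n}\sum_{v=1}^{m-1}\frac{(-1)^{v+1}t^{2m-2v}(\bar 1)}{2^{2v}(2m-2v)!}\left(S_{n}^{\{1\}_{2v}}-S_{n}^{\{1\}_{2v-1},-1}\right), \end{align*} \begin{align*}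 \int_0^1 x^{2n-1}\arctan^{2m-1}(x)\,dx={}&-\frac{1-(-1)^n}{2n}t^{2m-1}(\bar 1)+\frac{(-1)^{n+m}(2m-1)!}{2^{2m-1}(2n)}T_{n}^{\{1\}_{2m-2},-1}\\ &-\frac{(-1)^{n}(2m-1)!}{2n}\sum_{u=1}^{m-1}\frac{(-1)^uT_{n}^{\{1\}_{2u-1}}}{(2m-2u)!\,2^{2u-1}}A(2m-2u)\\ &+\frac{(-1)^{n}(2m-1)!}{2n}\sum_{v=1}^{m-1}\frac{(-1)^{v}t^{2m-2v}(\bar 1)}{2^{2v-1}(2m-2v)!}\left(T_{n}^{\{1\}_{2v-1}}+T_{n}^{\{1\}_{2v-2},-1}\right)\\ &+\frac{(-1)^{n}(2m-1)!}{2n}\sum_{v=1}^{m-1}\frac{(-1)^{v}t^{2m-2v-1}(\bar 1)}{2^{2v}(2m-2v-1)!}\left(S_{n}^{\{1\}_{2v}}-S_{n}^{\{1\}_{2v-1},-1}\right). \end{align*}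
   Context: For $n\in\mathbb{N}$ and signs $\sigma_1,\dots,\sigma_r\in\{\pm1\}$ the alternating multiple $T$- and $S$-harmonic sums with all arguments equal to $1$, denoted $T_n^{\sigma_1,\dots,\sigma_r}$ and $S_n^{\sigma_1,\dots,\sigma_r}$, are given recursively as follows. For $r=0$ both equal $1$. For $r\ge1$: $$T_n^{\sigma_1,\dots,\sigma_r}=\begin{cases}2\sum_{j=1}^{n}\dfrac{\sigma_1^j\,T_j^{\sigma_2,\dots,\sigma_r}}{2j-1}, & r\text{ odd},\\[2mm] 2\sum_{j=1}^{n-1}\dfrac{\sigma_1^j\,T_j^{\sigma_2,\dots,\sigma_r}}{2j}, & r\text{ even},\end{cases}\qquad S_n^{\sigma_1,\dots,\sigma_r}=\begin{cases}2\sum_{j=1}^{n-1}\dfrac{\sigma_1^j\,S_j^{\sigma_2,\dots,\sigma_r}}{2j}, & r\text{ odd},\\[2mm] 2\sum_{j=1}^{n}\dfrac{\sigma_1^j\,S_j^{\sigma_2,\dots,\sigma_r}}{2j-1}, & r\text{ even}.\end{cases}$$ Empty sums are $0$. The notation $\{1\}_p$ in a superscript means $1$ repeated $p$ times, so e.g. $T_n^{\{1\}_{p},-1}$ has $p+1$ signs, the last of which is $-1$, and $T_n^{\{1\}_0}=1$. *)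

theory Defs
  imports "HOL-Analysis.Analysis"
begin

(* The superscript (sigma_1, ..., sigma_r) is a list of signs 1 and -1, so that "r odd" is
   "odd (length of the list)"; the remaining signs (sigma_2, ..., sigma_r) are its tail. *)

primrec T_sum :: "real list \<Rightarrow> nat \<Rightarrow> real" where
  "T_sum [] n = 1"
| "T_sum (\<sigma> # \<sigma>s) n =
     (if odd (length (\<sigma> # \<sigma>s))
      then 2 * (\<Sum>j\<in>{1..n}. \<sigma> ^ j * T_sum \<sigma>s j / (2 * real j - 1))
      else 2 * (\<Sum>j\<in>{1..<n}. \<sigma> ^ j * T_sum \<sigma>s j / (2 * real j)))"

primrec S_sum :: "real list \<Rightarrow> nat \<Rightarrow> real" where
  "S_sum [] n = 1"
| "S_sum (\<sigma> # \<sigma>s) n =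
     (if odd (length (\<sigma> # \<sigma>s))
      then 2 * (\<Sum>j\<in>{1..<n}. \<sigma> ^ j * S_sum \<sigma>s j / (2 * real j))
      else 2 * (\<Sum>j\<in>{1..n}. \<sigma> ^ j * S_sum \<sigma>s j / (2 * real j - 1)))"

abbreviation ones :: "nat \<Rightarrow> real list" where
  "ones p \<equiv> replicate p 1"

abbreviation ones_neg :: "nat \<Rightarrow> real list" where
  "ones_neg p \<equiv> replicate p 1 @ [-1]"

definition A :: "nat \<Rightarrow> real" where
  "A p = integral {0..1} (\<lambda>x. arctan x ^ p)"

(* The series over n >= 1 of (-1)^n / (2n - 1), with the index shifted to start at 0. *)
definition t_bar1 :: real where
  "t_bar1 = (\<Sum>k. (-1) ^ Suc k / (2 * real (Suc k) - 1))"

lemma t_bar1_sums: "(\<lambda>k. (-1) ^ Suc k / (2 * real (Suc k) - 1)) sums t_bar1"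
  and t_bar1_eq: "t_bar1 = - (pi / 4)"
proof -
  have "(\<lambda>k. (-1) ^ k * (1 / real (k * 2 + 1))) sums (pi / 4)"
    using summable_arctan_series[of 1] pi_series by (simp add: sums_iff)
  then have "(\<lambda>k. - ((-1) ^ k * (1 / real (k * 2 + 1)))) sums - (pi / 4)"
    by (rule sums_minus)
  then have s: "(\<lambda>k. (-1) ^ Suc k / (2 * real (Suc k) - 1)) sums - (pi / 4)"
    by (simp add: algebra_simps)
  then show "t_bar1 = - (pi / 4)"
    unfolding t_bar1_def by (rule sums_unique[symmetric])
  with s show "(\<lambda>k. (-1) ^ Suc k / (2 * real (Suc k) - 1)) sums t_bar1"
    by simp
qed

end

theory Submission
  imports Defs
begin

text \<open>
  Integrating the derivative of \<open>(x ^ (k + 1) + x ^ (k + 3)) * arctan x ^ p\<close> relates the moments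
  of orders \<open>(k, p)\<close> and \<open>(k + 2, p)\<close> to the one of order \<open>(k + 1, p - 1)\<close>, without the
  denominator \<open>1 + x\<^sup>2\<close>. Weighted by \<open>(-1) ^ n * (2 * n - 1)\<close> and
  \<open>(-1) ^ n * (2 * n)\<close>, the even and odd moments telescope in \<open>n\<close>: those of arctangent power
  \<open>p\<close> are a boundary term plus a sum over \<open>1 / (2 * j)\<close>, resp. \<open>1 / (2 * j - 1)\<close>, of the odd,
  resp. even, moments of power \<open>p - 1\<close>. Iterating down to \<open>p = 0\<close>, where both weighted moments
  equal \<open>(-1) ^ n\<close>, applies alternating words in the two summation operators to the functions \<open>1\<close>
  and \<open>(-1) ^ n\<close>, which are exactly the \<open>T\<close>- and \<open>S\<close>-sums.
\<close>

section \<open>Arctangent moments and their recurrences\<close>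

definition arctan_moment :: "nat \<Rightarrow> nat \<Rightarrow> real" where
  "arctan_moment k p = integral {0..1} (\<lambda>x. x ^ k * arctan x ^ p)"

lemma integrable_arctan_moment [intro]:
  "(\<lambda>x::real. x ^ k * arctan x ^ p) integrable_on {0..1}"
  by (intro integrable_continuous_real continuous_intros)

lemma DERIV_arctan_power_Suc:
  "((\<lambda>x. arctan x ^ Suc p) has_real_derivative (real p + 1) * arctan x ^ p * inverse (1 + x\<^sup>2))
     (at x within S)"
  by (rule DERIV_cong[OF DERIV_power_Suc[OF DERIV_arctan[THEN DERIV_subset, OF subset_UNIV]]])
     (simp add: algebra_simps)

lemma arctan_moment_0: "arctan_moment k 0 = 1 / (real k + 1)"
proof -
  have "((\<lambda>x::real. x ^ k) has_integral (1 ^ Suc k / (real k + 1) - 0 ^ Suc k / (real k + 1))) {0..1}"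
    by (intro fundamental_theorem_of_calculus)
       (auto intro!: DERIV_cong[OF DERIV_cdivide[OF DERIV_power_Suc[OF DERIV_ident]]]
         simp: add.commute simp del: power_Suc simp flip: has_real_derivative_iff_has_vector_derivative)
  then show ?thesis
    by (simp add: arctan_moment_def integral_unique)
qed

lemma arctan_moment_recurrence:
  "(real k + 1) * arctan_moment k (Suc p) + (real k + 3) * arctan_moment (k + 2) (Suc p)
     = 2 * (pi / 4) ^ Suc p - (real p + 1) * arctan_moment (k + 1) p"
proof -
  let ?F = "\<lambda>x::real. (x ^ (k + 1) + x ^ (k + 3)) * arctan x ^ Suc p"
  let ?f = "\<lambda>x::real. (real k + 1) * (x ^ k * arctan x ^ Suc p)
      + (real k + 3) * (x ^ (k + 2) * arctan x ^ Suc p)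
      + (real p + 1) * (x ^ (k + 1) * arctan x ^ p)"
  have "(?F has_real_derivative ?f x) (at x within {0..1})" for x
  proof -
    have "(1 + x\<^sup>2) * inverse (1 + x\<^sup>2) = 1"
      by (simp add: add_nonneg_eq_0_iff)
    moreover have "(?F has_real_derivative
        ((real k + 1) * x ^ k + (real k + 3) * x ^ (k + 2)) * arctan x ^ Suc p
        + (x ^ (k + 1) + x ^ (k + 3)) * ((real p + 1) * arctan x ^ p * inverse (1 + x\<^sup>2)))
        (at x within {0..1})"
      by (rule DERIV_cong[OF DERIV_mult[OF DERIV_add[OF DERIV_pow DERIV_pow]
              DERIV_arctan_power_Suc]])
         (simp add: algebra_simps eval_nat_numeral)
    moreover have "x ^ (k + 1) + x ^ (k + 3) = x ^ (k + 1) * (1 + x\<^sup>2)"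
      by (simp add: algebra_simps eval_nat_numeral)
    then have "(x ^ (k + 1) + x ^ (k + 3)) * ((real p + 1) * arctan x ^ p * inverse (1 + x\<^sup>2))
        = (real p + 1) * (x ^ (k + 1) * arctan x ^ p) * ((1 + x\<^sup>2) * inverse (1 + x\<^sup>2))"
      by (simp only: mult_ac)
    ultimately show ?thesis
      by (elim DERIV_cong) (simp only: mult_1_right distrib_right mult.assoc)
  qed
  then have "(?f has_integral (?F 1 - ?F 0)) {0..1}"
    by (intro fundamental_theorem_of_calculus)
       (auto simp flip: has_real_derivative_iff_has_vector_derivative)
  then have "integral {0..1} ?f = ?F 1 - ?F 0"
    by (rule integral_unique)
  moreover have "integral {0..1} ?f = (real k + 1) * arctan_moment k (Suc p)
      + (real k + 3) * arctan_moment (k + 2) (Suc p) + (real p + 1) * arctan_moment (k + 1) p"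
    unfolding arctan_moment_def
    by (subst integral_add integral_mult_right;
        (intro integrable_add integrable_on_mult_right integrable_arctan_moment)?)+ simp
  \<comment> \<open>At 1 the polynomial factor is 2 and \<open>arctan\<close> is
    \<open>pi / 4\<close>; at 0 the positive powers of \<open>x\<close> vanish.\<close>
  ultimately show ?thesis
    by (simp add: arctan_one)
qed

text \<open>This is the recurrence at the formal value \<open>k = -1\<close>: the coefficient
  \<open>k + 1\<close> vanishes there, so no moment of order -1 enters. At 0 the primitive now
  vanishes because \<open>arctan 0 = 0\<close>.\<close>

lemma arctan_moment_1:
  "2 * arctan_moment 1 (Suc p) = 2 * (pi / 4) ^ Suc p - (real p + 1) * A p"
proof -
  let ?F = "\<lambda>x::real. (1 + x\<^sup>2) * arctan x ^ Suc p"
  let ?f = "\<lambda>x::real. 2 * (x ^ 1 * arctan x ^ Suc p) + (real p + 1) * (x ^ 0 * arctan x ^ p)"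
  have "(?F has_real_derivative ?f x) (at x within {0..1})" for x
  proof -
    have "(1 + x\<^sup>2) * inverse (1 + x\<^sup>2) = 1"
      by (simp add: add_nonneg_eq_0_iff)
    moreover have "(?F has_real_derivative
        2 * x * arctan x ^ Suc p
        + (1 + x\<^sup>2) * ((real p + 1) * arctan x ^ p * inverse (1 + x\<^sup>2)))
        (at x within {0..1})"
      by (rule DERIV_cong[OF DERIV_mult[OF DERIV_add[OF DERIV_const DERIV_pow]
              DERIV_arctan_power_Suc]])
         (simp add: algebra_simps)
    ultimately show ?thesis
      by (simp add: algebra_simps)
  qed
  then have "(?f has_integral (?F 1 - ?F 0)) {0..1}"
    by (intro fundamental_theorem_of_calculus)
       (auto simp flip: has_real_derivative_iff_has_vector_derivative)
  then have "integral {0..1} ?f = ?F 1 - ?F 0"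
    by (rule integral_unique)
  moreover have "integral {0..1} ?f = 2 * arctan_moment 1 (Suc p) + (real p + 1) * arctan_moment 0 p"
    unfolding arctan_moment_def
    by (subst integral_add integral_mult_right;
        (intro integrable_add integrable_on_mult_right integrable_arctan_moment)?)+ simp
  ultimately show ?thesis
    by (simp add: arctan_one arctan_moment_def A_def)
qed

section \<open>Outer layers of T- and S-sums as linear operators, and the weighted moments\<close>

definition odd_sum :: "(nat \<Rightarrow> real) \<Rightarrow> nat \<Rightarrow> real" where
  "odd_sum f n = 2 * (\<Sum>j\<in>{1..n}. f j / (2 * real j - 1))"

definition even_sum :: "(nat \<Rightarrow> real) \<Rightarrow> nat \<Rightarrow> real" where
  "even_sum f n = 2 * (\<Sum>j\<in>{1..<n}. f j / (2 * real j))"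

lemma odd_sum_cong: "(\<And>j. j \<ge> 1 \<Longrightarrow> f j = g j) \<Longrightarrow> odd_sum f n = odd_sum g n"
  by (simp add: odd_sum_def)

lemma even_sum_cong: "(\<And>j. j \<ge> 1 \<Longrightarrow> f j = g j) \<Longrightarrow> even_sum f n = even_sum g n"
  by (simp add: even_sum_def)

lemma odd_sum_linear:
  "odd_sum (\<lambda>j. f j + g j) n = odd_sum f n + odd_sum g n"
  "odd_sum (\<lambda>j. f j - g j) n = odd_sum f n - odd_sum g n"
  "odd_sum (\<lambda>j. c * f j) n = c * odd_sum f n"
  "odd_sum (\<lambda>j. - f j) n = - odd_sum f n"
  "odd_sum (\<lambda>j. \<Sum>k\<in>K. h k j) n = (\<Sum>k\<in>K. odd_sum (h k) n)"
  by (simp_all add: odd_sum_def add_divide_distrib diff_divide_distrib sum.distrib sum_subtractf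
      sum_distrib_left sum_divide_distrib sum_negf mult_ac sum.swap[of _ K])

lemma even_sum_linear:
  "even_sum (\<lambda>j. f j + g j) n = even_sum f n + even_sum g n"
  "even_sum (\<lambda>j. f j - g j) n = even_sum f n - even_sum g n"
  "even_sum (\<lambda>j. c * f j) n = c * even_sum f n"
  "even_sum (\<lambda>j. - f j) n = - even_sum f n"
  "even_sum (\<lambda>j. \<Sum>k\<in>K. h k j) n = (\<Sum>k\<in>K. even_sum (h k) n)"
  by (simp_all add: even_sum_def add_divide_distrib diff_divide_distrib sum.distrib sum_subtractf
      sum_distrib_left sum_divide_distrib sum_negf mult_ac sum.swap[of _ K])

text \<open>The factor \<open>2 ^ p / fact p\<close> absorbs the factors \<open>p\<close> that arise at each step of the recursion.\<close>

definition even_moment :: "nat \<Rightarrow> nat \<Rightarrow> real" where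
  "even_moment p n = 2 ^ p / fact p * ((-1) ^ n * (2 * real n - 1) * arctan_moment (2 * n - 2) p)"

definition odd_moment :: "nat \<Rightarrow> nat \<Rightarrow> real" where
  "odd_moment p n = 2 ^ p / fact p * ((-1) ^ n * (2 * real n) * arctan_moment (2 * n - 1) p)"

text \<open>The endpoint value \<open>arctan 1 = pi / 4\<close>, normalised like the
  moments.\<close>

definition boundary_coeff :: "nat \<Rightarrow> real" where
  "boundary_coeff q = 2 ^ q * (pi / 4) ^ q / fact q"

text \<open>Up to sign this is \<open>even_moment q 1\<close>, the initial value of the
  telescoping.\<close>

definition A_coeff :: "nat \<Rightarrow> real" where
  "A_coeff q = 2 ^ q * A q / fact q"

lemma even_moment_0: "n \<ge> 1 \<Longrightarrow> even_moment 0 n = (-1) ^ n"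
  and odd_moment_0: "n \<ge> 1 \<Longrightarrow> odd_moment 0 n = (-1) ^ n"
  by (simp_all add: even_moment_def odd_moment_def arctan_moment_0 of_nat_diff)

text \<open>The weight \<open>(-1) ^ n\<close> turns the sum of two moments in the recurrence into a
  difference, so passing from \<open>n\<close> to \<open>Suc n\<close> adds a boundary term and one
  summand of \<open>even_sum\<close>. At \<open>n = 1\<close> the boundary factor and the sum
  vanish, which leaves the initial moment.\<close>

lemma even_moment_Suc:
  assumes "n \<ge> 1"
  shows "even_moment (Suc p) n
    = boundary_coeff (Suc p) * (1 + (-1) ^ n) - A_coeff (Suc p) + even_sum (odd_moment p) n"
  using assms
proof (induction n rule: nat_induct_at_least)
  case base
  show ?case
    by (simp add: even_moment_def A_coeff_def even_sum_def arctan_moment_def A_def)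
next
  case (Suc n)
  define c where "c = (2::real) ^ Suc p / fact (Suc p)"
  have eq: "2 * n - 2 + 2 = 2 * n" "2 * n - 2 + 1 = 2 * n - 1" "real (2 * n - 2) = 2 * real n - 2"
    using Suc.hyps by (auto simp: of_nat_diff)
  have "(2 * real n - 1) * arctan_moment (2 * n - 2) (Suc p)
      + (2 * real n + 1) * arctan_moment (2 * n) (Suc p)
      = 2 * (pi / 4) ^ Suc p - (real p + 1) * arctan_moment (2 * n - 1) p"
    using arctan_moment_recurrence[of "2 * n - 2" p] unfolding eq by (simp add: algebra_simps)
  then have rec: "(2 * real n + 1) * arctan_moment (2 * n) (Suc p) = 2 * (pi / 4) ^ Suc p
      - (real p + 1) * arctan_moment (2 * n - 1) p - (2 * real n - 1) * arctan_moment (2 * n - 2) (Suc p)"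
    by linarith
  have "even_moment (Suc p) (Suc n)
      = - c * (-1) ^ n * ((2 * real n + 1) * arctan_moment (2 * n) (Suc p))"
    by (simp add: even_moment_def c_def)
  also have "\<dots> = even_moment (Suc p) n - 2 * (-1) ^ n * (c * (pi / 4) ^ Suc p)
      + c * (real p + 1) * ((-1) ^ n * arctan_moment (2 * n - 1) p)"
    unfolding rec even_moment_def c_def[symmetric] by (simp add: algebra_simps)
  also have "c * (pi / 4) ^ Suc p = boundary_coeff (Suc p)"
    by (simp add: c_def boundary_coeff_def)
  \<comment> \<open>Raising the power by one multiplies the normalising factor by
    \<open>2 / (p + 1)\<close>: the \<open>p + 1\<close> from the derivative cancels, and the
    surviving 2 is the factor in front of \<open>even_sum\<close>.\<close>
  also have "c * (real p + 1) = 2 * 2 ^ p / fact p"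
    by (simp add: c_def divide_simps)
  also have "2 * 2 ^ p / fact p * ((-1) ^ n * arctan_moment (2 * n - 1) p)
      = 2 * odd_moment p n / (2 * real n)"
    using Suc.hyps by (simp add: odd_moment_def)
  also have "\<dots> = even_sum (odd_moment p) (Suc n) - even_sum (odd_moment p) n"
    using Suc.hyps by (simp add: even_sum_def algebra_simps)
  finally show ?case
    using Suc.IH by (simp add: algebra_simps)
qed

text \<open>Here the telescoping starts at 0, where the weight \<open>2 * real n\<close> vanishes,
  so no constant \<open>A\<close> arises.\<close>

lemma odd_moment_Suc:
  "odd_moment (Suc p) n = boundary_coeff (Suc p) * ((-1) ^ n - 1) - odd_sum (even_moment p) n"
proof (induction n)
  case 0
  show ?case
    by (simp add: odd_moment_def odd_sum_def)
next
  case (Suc n)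
  define c where "c = (2::real) ^ Suc p / fact (Suc p)"
  have rec: "(2 * real n + 2) * arctan_moment (2 * n + 1) (Suc p) = 2 * (pi / 4) ^ Suc p
      - (real p + 1) * arctan_moment (2 * n) p - 2 * real n * arctan_moment (2 * n - 1) (Suc p)"
  \<comment> \<open>At \<open>n = 0\<close> the exponent \<open>2 * n - 1\<close> truncates to 0,
    but the coefficient of that moment is 0, and the claim is
    \<open>arctan_moment_1\<close>.\<close>
  proof (cases "n = 0")
    case True
    then show ?thesis
      using arctan_moment_1[of p] by (simp add: arctan_moment_def A_def)
  next
    case False
    then have eq: "2 * n - 1 + 2 = 2 * n + 1" "2 * n - 1 + 1 = 2 * n" "real (2 * n - 1) = 2 * real n - 1"
      by (auto simp: of_nat_diff)
    show ?thesis
      using arctan_moment_recurrence[of "2 * n - 1" p] unfolding eq by (simp add: algebra_simps)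
  qed
  have "odd_moment (Suc p) (Suc n)
      = - c * (-1) ^ n * ((2 * real n + 2) * arctan_moment (2 * n + 1) (Suc p))"
    by (simp add: odd_moment_def c_def algebra_simps)
  also have "\<dots> = odd_moment (Suc p) n - 2 * (-1) ^ n * (c * (pi / 4) ^ Suc p)
      + c * (real p + 1) * ((-1) ^ n * arctan_moment (2 * n) p)"
    unfolding rec odd_moment_def c_def[symmetric] by (simp add: algebra_simps)
  also have "c * (pi / 4) ^ Suc p = boundary_coeff (Suc p)"
    by (simp add: c_def boundary_coeff_def)
  also have "c * (real p + 1) = 2 * 2 ^ p / fact p"
    by (simp add: c_def divide_simps)
  \<comment> \<open>The exponent \<open>2 * n\<close> belongs to the even moment of index
    \<open>Suc n\<close>, so the new summand has index \<open>Suc n\<close>; its sign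
    \<open>(-1) ^ Suc n\<close> is the source of the minus before \<open>odd_sum\<close>.\<close>
  also have "2 * 2 ^ p / fact p * ((-1) ^ n * arctan_moment (2 * n) p)
      = - (2 * even_moment p (Suc n) / (2 * real (Suc n) - 1))"
    by (simp add: even_moment_def add_nonneg_eq_0_iff field_simps)
  also have "\<dots> = odd_sum (even_moment p) n - odd_sum (even_moment p) (Suc n)"
    by (simp add: odd_sum_def algebra_simps)
  finally show ?case
    using Suc.IH by (simp add: algebra_simps)
qed

section \<open>Iterated operators and the expansion of the moments\<close>

definition T_family :: "(nat \<Rightarrow> nat \<Rightarrow> real) \<Rightarrow> bool" where
  "T_family x \<longleftrightarrow>
     (\<forall>k n. n \<ge> 1 \<longrightarrow> x (Suc k) n = (if even k then odd_sum (x k) n else even_sum (x k) n))"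

definition S_family :: "(nat \<Rightarrow> nat \<Rightarrow> real) \<Rightarrow> bool" where
  "S_family y \<longleftrightarrow>
     (\<forall>k n. n \<ge> 1 \<longrightarrow> y (Suc k) n = (if even k then even_sum (y k) n else odd_sum (y k) n))"

text \<open>The index counts signs, so position \<open>0\<close> holds the innermost summand \<open>(-1) ^ n\<close> itself.\<close>

definition T_neg :: "nat \<Rightarrow> nat \<Rightarrow> real" where
  "T_neg k n = (case k of 0 \<Rightarrow> (-1) ^ n | Suc l \<Rightarrow> T_sum (ones_neg l) n)"

definition S_neg :: "nat \<Rightarrow> nat \<Rightarrow> real" where
  "S_neg k n = (case k of 0 \<Rightarrow> (-1) ^ n | Suc l \<Rightarrow> S_sum (ones_neg l) n)"

lemma T_family_T_sum: "T_family (\<lambda>k. T_sum (ones k))"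
  by (simp add: T_family_def odd_sum_def even_sum_def)

lemma S_family_S_sum: "S_family (\<lambda>k. S_sum (ones k))"
  by (simp add: S_family_def odd_sum_def even_sum_def)

text \<open>The innermost sign -1 multiplies the value 1 of the empty word by
  \<open>(-1) ^ j\<close>, so a final -1 amounts to starting the same recursion from
  \<open>(-1) ^ n\<close> instead of 1.\<close>

lemma T_family_T_neg: "T_family T_neg"
proof -
  have "T_neg (Suc k) n = T_sum (replicate k 1 @ [-1]) n" for k n
    by (simp add: T_neg_def)
  moreover have "T_neg 0 n = (-1) ^ n" for n
    by (simp add: T_neg_def)
  ultimately show ?thesis
    unfolding T_family_def by (intro allI; case_tac k) (simp_all add: odd_sum_def even_sum_def)
qed

lemma S_family_S_neg: "S_family S_neg"
proof -
  have "S_neg (Suc k) n = S_sum (replicate k 1 @ [-1]) n" for k n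
    by (simp add: S_neg_def)
  moreover have "S_neg 0 n = (-1) ^ n" for n
    by (simp add: S_neg_def)
  ultimately show ?thesis
    unfolding S_family_def by (intro allI; case_tac k) (simp_all add: odd_sum_def even_sum_def)
qed

lemma T_family_combination:
  "T_family x \<Longrightarrow> T_family y \<Longrightarrow> T_family (\<lambda>k n. a * x k n + b * y k n)"
  by (simp add: T_family_def odd_sum_linear even_sum_linear)

lemma S_family_combination:
  "S_family x \<Longrightarrow> S_family y \<Longrightarrow> S_family (\<lambda>k n. a * (x k n - y k n))"
  by (simp add: S_family_def odd_sum_linear even_sum_linear)

text \<open>What \<open>k\<close> recursion steps, the outermost being \<open>even_sum\<close>, make
  of a contribution entering innermost. For even \<open>k > 0\<close> the innermost operator is
  \<open>odd_sum\<close>, the T pattern; for odd \<open>k\<close> it is \<open>even_sum\<close>, the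
  S pattern. Each \<open>odd_sum\<close> brings a minus sign, and there are \<open>k div 2\<close>
  of them.\<close>

definition even_term :: "(nat \<Rightarrow> nat \<Rightarrow> real) \<Rightarrow> (nat \<Rightarrow> nat \<Rightarrow> real) \<Rightarrow> nat \<Rightarrow> nat \<Rightarrow> real" where
  "even_term x y k n = (-1) ^ (k div 2) * (if even k then x k n else y k n)"

text \<open>With \<open>odd_sum\<close> outermost the two patterns trade places, and for odd
  \<open>k\<close> there is one \<open>odd_sum\<close> more than \<open>k div 2\<close>, hence the
  extra minus.\<close>

definition odd_term :: "(nat \<Rightarrow> nat \<Rightarrow> real) \<Rightarrow> (nat \<Rightarrow> nat \<Rightarrow> real) \<Rightarrow> nat \<Rightarrow> nat \<Rightarrow> real" where
  "odd_term x y k n = (-1) ^ (k div 2) * (if even k then y k n else - x k n)"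

lemma even_term_Suc:
  assumes "T_family x" "S_family y" "n \<ge> 1"
  shows "even_term x y (Suc k) n = even_sum (odd_term x y k) n"
  using assms
  by (cases "even k")
     (auto simp: even_term_def[abs_def] odd_term_def[abs_def] T_family_def S_family_def even_sum_linear
       elim!: oddE evenE)

lemma odd_term_Suc:
  assumes "T_family x" "S_family y" "n \<ge> 1"
  shows "odd_term x y (Suc k) n = - odd_sum (even_term x y k) n"
  using assms
  by (cases "even k")
     (auto simp: even_term_def[abs_def] odd_term_def[abs_def] T_family_def S_family_def odd_sum_linear
       elim!: oddE evenE)

text \<open>At \<open>k = 0\<close> this and \<open>S_comb\<close> are the inhomogeneous terms of
  \<open>even_moment_Suc\<close> and \<open>odd_moment_Suc\<close> for power \<open>q\<close>;
  larger \<open>k\<close> follows them through the operators by linearity.\<close>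

definition T_comb :: "nat \<Rightarrow> nat \<Rightarrow> nat \<Rightarrow> real" where
  "T_comb q k n = (boundary_coeff q - A_coeff q) * T_sum (ones k) n + boundary_coeff q * T_neg k n"

definition S_comb :: "nat \<Rightarrow> nat \<Rightarrow> nat \<Rightarrow> real" where
  "S_comb q k n = boundary_coeff q * (S_neg k n - S_sum (ones k) n)"

lemma T_family_T_comb: "T_family (T_comb q)"
  unfolding T_comb_def[abs_def]
  by (intro T_family_combination T_family_T_sum T_family_T_neg)

lemma S_family_S_comb: "S_family (S_comb q)"
  unfolding S_comb_def[abs_def]
  by (intro S_family_combination S_family_S_sum S_family_S_neg)

text \<open>After \<open>k\<close> steps the power has dropped to \<open>p - k\<close>, whose
  inhomogeneous term contributes at depth \<open>k\<close>; the last term comes from power 0, where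
  both moments are \<open>(-1) ^ n\<close>. Each step exchanges even and odd moments, so both claims
  share one induction.\<close>

lemma moment_expansion:
  assumes "n \<ge> 1"
  shows "even_moment p n
           = (\<Sum>k<p. even_term (T_comb (p - k)) (S_comb (p - k)) k n) + even_term T_neg S_neg p n"
    and "odd_moment p n
           = (\<Sum>k<p. odd_term (T_comb (p - k)) (S_comb (p - k)) k n) + odd_term T_neg S_neg p n"
  using assms
proof (induction p arbitrary: n)
  case 0
  {
    case 1
    then show ?case by (simp add: even_moment_0 even_term_def T_neg_def)
  next
    case 2
    then show ?case by (simp add: odd_moment_0 odd_term_def S_neg_def)
  }
next
  case (Suc p)
  {
    case 1
    have "even_sum (odd_moment p) n = even_sum (\<lambda>n.
        (\<Sum>k<p. odd_term (T_comb (p - k)) (S_comb (p - k)) k n) + odd_term T_neg S_neg p n) n"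
      by (intro even_sum_cong Suc.IH)
    also have "\<dots> = (\<Sum>k<p. even_term (T_comb (p - k)) (S_comb (p - k)) (Suc k) n)
        + even_term T_neg S_neg (Suc p) n"
      using 1 by (simp add: even_sum_linear even_term_Suc T_family_T_comb S_family_S_comb
          T_family_T_neg S_family_S_neg)
    finally show ?case
      \<comment> \<open>The split-off index 0 is the new inhomogeneous term; the others shift by
        one, which preserves the difference \<open>p - k\<close>.\<close>
      using 1 unfolding sum.lessThan_Suc_shift
      by (simp add: even_moment_Suc even_term_def T_comb_def T_neg_def algebra_simps)
  next
    case 2
    have "odd_sum (even_moment p) n = odd_sum (\<lambda>n.
        (\<Sum>k<p. even_term (T_comb (p - k)) (S_comb (p - k)) k n) + even_term T_neg S_neg p n) n"
      by (intro odd_sum_cong Suc.IH)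
    also have "\<dots> = - ((\<Sum>k<p. odd_term (T_comb (p - k)) (S_comb (p - k)) (Suc k) n)
        + odd_term T_neg S_neg (Suc p) n)"
      using 2 by (simp add: odd_sum_linear odd_term_Suc T_family_T_comb S_family_S_comb
          T_family_T_neg S_family_S_neg sum_negf)
    finally show ?case
      using 2 unfolding sum.lessThan_Suc_shift
      by (simp add: odd_moment_Suc odd_term_def S_comb_def S_neg_def algebra_simps)
  }
qed

section \<open>Expansion terms as powers of \<open>t_bar1\<close>\<close>

lemma T_neg_pos: "k \<ge> 1 \<Longrightarrow> T_neg k n = T_sum (ones_neg (k - 1)) n"
  and S_neg_pos: "k \<ge> 1 \<Longrightarrow> S_neg k n = S_sum (ones_neg (k - 1)) n"
  by (cases k; simp add: T_neg_def S_neg_def)+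

text \<open>Dividing by \<open>2 ^ p\<close> undoes the normalisation: \<open>2 ^ (p - k)\<close>
  cancels against the coefficients and \<open>2 ^ k\<close> remains. The parameter \<open>s\<close>
  carries the sign of the term.\<close>

lemma T_comb_scaled:
  assumes "k \<le> p"
  shows "s * T_comb (p - k) k n / 2 ^ p
    = s * (- t_bar1) ^ (p - k) / (2 ^ k * fact (p - k)) * (T_sum (ones k) n + T_neg k n)
      - s * T_sum (ones k) n / (fact (p - k) * 2 ^ k) * A (p - k)"
proof -
  have "(2::real) ^ p = 2 ^ (p - k) * 2 ^ k"
    using assms by (simp flip: power_add)
  then show ?thesis
    by (simp add: T_comb_def boundary_coeff_def A_coeff_def t_bar1_eq field_simps)
qed

lemma S_comb_scaled:
  assumes "k \<le> p"
  shows "s * S_comb (p - k) k n / 2 ^ p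
    = - (s * (- t_bar1) ^ (p - k) / (2 ^ k * fact (p - k)) * (S_sum (ones k) n - S_neg k n))"
proof -
  have "(2::real) ^ p = 2 ^ (p - k) * 2 ^ k"
    using assms by (simp flip: power_add)
  then show ?thesis
    by (simp add: S_comb_def boundary_coeff_def t_bar1_eq field_simps)
qed

section \<open>Splitting sums by the parity of the index\<close>

lemma sum_lessThan_double:
  fixes f :: "nat \<Rightarrow> real"
  assumes "m \<ge> 1"
  shows "(\<Sum>k<2*m. f k) = (\<Sum>u\<in>{0..m-1}. f (2*u)) + (\<Sum>v\<in>{0..m-1}. f (2 * v+1))"
proof -
  have "(\<Sum>k<2 * Suc l. f k) = (\<Sum>u\<in>{0..l}. f (2*u)) + (\<Sum>v\<in>{0..l}. f (2 * v+1))" for l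
    by (induction l) (simp_all add: numeral_2_eq_2)
  from this[of "m - 1"] assms show ?thesis by simp
qed

text \<open>The last index \<open>2 * m - 2\<close> is even, so there is one odd index fewer; hence
  the range of \<open>v\<close> starting at 1.\<close>

lemma sum_lessThan_double_minus_one:
  fixes f :: "nat \<Rightarrow> real"
  assumes "m \<ge> 1"
  shows "(\<Sum>k<2*m-1. f k) = (\<Sum>u\<in>{0..m-1}. f (2*u)) + (\<Sum>v\<in>{1..m-1}. f (2 * v-1))"
proof -
  have "(\<Sum>k<2 * Suc l - 1. f k) = (\<Sum>u\<in>{0..l}. f (2*u)) + (\<Sum>v\<in>{1..l}. f (2 * v-1))" for l
    by (induction l) simp_all
  from this[of "m - 1"] assms show ?thesis by simp
qed

text \<open>Isolates the depth-0 boundary contribution, where \<open>(-1) ^ n\<close> itself stands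
  in place of a sum.\<close>

lemma sum_split_0:
  fixes f :: "nat \<Rightarrow> real"
  shows "(\<Sum>k\<in>{0..l}. f k) = f 0 + (\<Sum>k\<in>{1..l}. f k)"
  by (simp add: sum.atLeast_Suc_atMost)

section \<open>The four parity cases of the expansion\<close>

lemma arctan_moment_even_eq:
  assumes "n \<ge> 1"
  shows "arctan_moment (2 * n - 2) p
    = (-1) ^ n * fact p / (2 * real n - 1) * (even_moment p n / 2 ^ p)"
proof -
  have "2 * real n - 1 \<noteq> 0" using assms by linarith
  then show ?thesis by (simp add: even_moment_def)
qed

lemma arctan_moment_odd_eq:
  assumes "n \<ge> 1"
  shows "arctan_moment (2 * n - 1) p
    = (-1) ^ n * fact p / (2 * real n) * (odd_moment p n / 2 ^ p)"
  using assms by (simp add: odd_moment_def)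

text \<open>Even depths give the T-terms and the integrals \<open>A\<close>, odd depths the S-terms.
  In the latter the minus of \<open>S_comb_scaled\<close> cancels against the odd power of
  \<open>- t_bar1\<close>.\<close>

lemma even_moment_double_scaled:
  assumes "n \<ge> 1" "m \<ge> 1"
  shows "even_moment (2*m) n / 2 ^ (2*m) =
      (1 + (-1)^n) * t_bar1 ^ (2*m) / fact (2*m)
      + (-1)^m / 2^(2*m) * T_sum (ones_neg (2*m-1)) n
      - (\<Sum>u\<in>{0..m-1}. (-1)^u * T_sum (ones (2*u)) n / (fact (2*m-2*u) * 2^(2*u)) * A (2*m-2*u))
      + (\<Sum>v\<in>{1..m-1}. (-1)^v * t_bar1 ^ (2*m-2 * v) / (2^(2 * v) * fact (2*m-2 * v))
             * (T_sum (ones (2 * v)) n + T_sum (ones_neg (2 * v-1)) n))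
      + (\<Sum>v\<in>{0..m-1}. (-1)^v * t_bar1 ^ (2*m-2 * v-1) / (2^(2 * v+1) * fact (2*m-2 * v-1))
             * (S_sum (ones (2 * v+1)) n - S_sum (ones_neg (2 * v)) n))"
    (is "_ = ?B + ?E - ?a + ?b + ?c")
proof -
  let ?f = "\<lambda>k. even_term (T_comb (2*m - k)) (S_comb (2*m - k)) k n / 2 ^ (2*m)"
  \<comment> \<open>\<open>T_neg\<close> keeps the term \<open>v = 0\<close> correct: there
    \<open>ones_neg (2 * v - 1)\<close> would truncate to the word \<open>[-1]\<close>.\<close>
  let ?b' = "\<lambda>v. (-1)^v * t_bar1 ^ (2*m-2 * v) / (2^(2 * v) * fact (2*m-2 * v))
             * (T_sum (ones (2 * v)) n + T_neg (2 * v) n)"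
  have "(\<Sum>u\<in>{0..m-1}. ?f (2*u)) = (\<Sum>u\<in>{0..m-1}. ?b' u
      - (-1)^u * T_sum (ones (2*u)) n / (fact (2*m-2*u) * 2^(2*u)) * A (2*m-2*u))"
  proof (rule sum.cong[OF refl])
    fix u assume "u \<in> {0..m-1}"
    then have "2 * u \<le> 2 * m" by auto
    from T_comb_scaled[OF this, of "(-1) ^ u" n]
    show "?f (2*u) = ?b' u
      - (-1)^u * T_sum (ones (2*u)) n / (fact (2*m-2*u) * 2^(2*u)) * A (2*m-2*u)"
      by (simp add: even_term_def)
  qed
  also have "\<dots> = (\<Sum>v\<in>{0..m-1}. ?b' v) - ?a"
    by (rule sum_subtractf)
  also have "(\<Sum>v\<in>{0..m-1}. ?b' v) = ?b' 0 + (\<Sum>v\<in>{1..m-1}. ?b' v)"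
    by (rule sum_split_0)
  also have "?b' 0 = ?B" by (simp add: T_neg_def field_simps)
  also have "(\<Sum>v\<in>{1..m-1}. ?b' v) = ?b"
    by (intro sum.cong refl) (simp add: T_neg_pos)
  finally have 1: "(\<Sum>u\<in>{0..m-1}. ?f (2*u)) = ?B + ?b - ?a" .
  have 2: "(\<Sum>v\<in>{0..m-1}. ?f (2 * v+1)) = ?c"
  proof (rule sum.cong[OF refl])
    fix v assume "v \<in> {0..m-1}"
    then have "2 * v + 1 \<le> 2 * m" using assms by auto
    \<comment> \<open>The bound also settles the parity of the truncated exponent, hence the sign of
      the power of \<open>- t_bar1\<close>.\<close>
    from this S_comb_scaled[OF this, of "(-1) ^ v" n]
    show "?f (2 * v+1) = (-1)^v * t_bar1 ^ (2*m-2 * v-1) / (2^(2 * v+1) * fact (2*m-2 * v-1))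
             * (S_sum (ones (2 * v+1)) n - S_sum (ones_neg (2 * v)) n)"
      by (simp add: even_term_def S_neg_pos del: replicate_Suc power_Suc)
  qed
  have 3: "even_term T_neg S_neg (2*m) n / 2 ^ (2*m) = ?E"
    using assms by (simp add: even_term_def T_neg_pos)
  have "even_moment (2*m) n / 2 ^ (2*m) = (\<Sum>k<2*m. ?f k) + even_term T_neg S_neg (2*m) n / 2 ^ (2*m)"
    using assms by (simp add: moment_expansion add_divide_distrib sum_divide_distrib)
  then show ?thesis
    unfolding sum_lessThan_double[OF assms(2)] 1 2 3 by simp
qed

text \<open>Now T-terms carry odd powers of \<open>- t_bar1\<close>, which gives
  \<open>(-1) ^ (v + 1)\<close>, and the last depth \<open>2 * m - 1\<close> is odd, so the final
  term is an S-sum with sign \<open>(-1) ^ (m - 1)\<close>.\<close>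

lemma even_moment_double_minus_one_scaled:
  assumes "n \<ge> 1" "m \<ge> 1"
  shows "even_moment (2*m-1) n / 2 ^ (2*m-1) =
      - (1 + (-1)^n) * t_bar1 ^ (2*m-1) / fact (2*m-1)
      - (-1)^m / 2^(2*m-1) * S_sum (ones_neg (2*m-2)) n
      - (\<Sum>u\<in>{0..m-1}. (-1)^u * T_sum (ones (2*u)) n / (fact (2*m-2*u-1) * 2^(2*u)) * A (2*m-2*u-1))
      + (\<Sum>v\<in>{1..m-1}. (-1)^(v+1) * t_bar1 ^ (2*m-2 * v-1) / (2^(2 * v) * fact (2*m-2 * v-1))
             * (T_sum (ones (2 * v)) n + T_sum (ones_neg (2 * v-1)) n))
      + (\<Sum>v\<in>{1..m-1}. (-1)^v * t_bar1 ^ (2*m-2 * v) / (2^(2 * v-1) * fact (2*m-2 * v))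
             * (S_sum (ones (2 * v-1)) n - S_sum (ones_neg (2 * v-2)) n))"
    (is "_ = ?B - ?E - ?a + ?b + ?c")
proof -
  let ?p = "2 * m - 1"
  let ?f = "\<lambda>k. even_term (T_comb (?p - k)) (S_comb (?p - k)) k n / 2 ^ ?p"
  let ?b' = "\<lambda>v. (-1)^(v+1) * t_bar1 ^ (2*m-2 * v-1) / (2^(2 * v) * fact (2*m-2 * v-1))
             * (T_sum (ones (2 * v)) n + T_neg (2 * v) n)"
  have "(\<Sum>u\<in>{0..m-1}. ?f (2*u)) = (\<Sum>u\<in>{0..m-1}. ?b' u
      - (-1)^u * T_sum (ones (2*u)) n / (fact (2*m-2*u-1) * 2^(2*u)) * A (2*m-2*u-1))"
  proof (rule sum.cong[OF refl])
    fix u assume "u \<in> {0..m-1}"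
    then have u: "2 * u \<le> ?p" "2 * u + 1 \<le> 2 * m" and eq: "?p - 2 * u = 2*m-2*u-1"
      using assms by auto
    from u T_comb_scaled[OF u(1), of "(-1) ^ u" n]
    show "?f (2*u) = ?b' u
      - (-1)^u * T_sum (ones (2*u)) n / (fact (2*m-2*u-1) * 2^(2*u)) * A (2*m-2*u-1)"
      unfolding eq by (simp add: even_term_def)
  qed
  also have "\<dots> = (\<Sum>v\<in>{0..m-1}. ?b' v) - ?a"
    by (rule sum_subtractf)
  also have "(\<Sum>v\<in>{0..m-1}. ?b' v) = ?b' 0 + (\<Sum>v\<in>{1..m-1}. ?b' v)"
    by (rule sum_split_0)
  also have "?b' 0 = ?B" by (simp add: T_neg_def field_simps)
  also have "(\<Sum>v\<in>{1..m-1}. ?b' v) = ?b"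
    by (intro sum.cong refl) (simp add: T_neg_pos)
  finally have 1: "(\<Sum>u\<in>{0..m-1}. ?f (2*u)) = ?B + ?b - ?a" .
  have 2: "(\<Sum>v\<in>{1..m-1}. ?f (2 * v-1)) = ?c"
  proof (rule sum.cong[OF refl])
    fix v assume "v \<in> {1..m-1}"
    \<comment> \<open>Depth \<open>2 * v - 1 = 2 * w + 1\<close> has sign exponent
      \<open>w = v - 1\<close>; the minus of \<open>S_comb_scaled\<close> turns it into
      \<open>(-1) ^ v\<close>.\<close>
    then obtain w where w: "v = Suc w" "2 * w + 1 \<le> ?p" and eq: "?p - (2 * w + 1) = 2 * m - 2 * v"
      by (cases v) auto
    from w S_comb_scaled[OF w(2), of "(-1) ^ w" n]
    show "?f (2 * v-1) = (-1)^v * t_bar1 ^ (2*m-2 * v) / (2^(2 * v-1) * fact (2*m-2 * v))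
             * (S_sum (ones (2 * v-1)) n - S_sum (ones_neg (2 * v-2)) n)"
      unfolding eq by (simp add: even_term_def S_neg_pos eq[simplified w(1)]
          del: replicate_Suc)
  qed
  obtain l where l: "m = Suc l" using assms by (cases m) auto
  have 3: "even_term T_neg S_neg ?p n / 2 ^ ?p = - ?E"
    by (simp add: l even_term_def S_neg_pos)
  have "even_moment ?p n / 2 ^ ?p = (\<Sum>k<?p. ?f k) + even_term T_neg S_neg ?p n / 2 ^ ?p"
    using assms by (simp add: moment_expansion add_divide_distrib sum_divide_distrib)
  then show ?thesis
    unfolding sum_lessThan_double_minus_one[OF assms(2)] 1 2 3 by simp
qed

text \<open>T-terms now sit at odd depths, where the extra minus of \<open>odd_term\<close> makes
  the \<open>A\<close>-sum positive and cancels against the odd powers of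
  \<open>- t_bar1\<close>.\<close>

lemma odd_moment_double_scaled:
  assumes "n \<ge> 1" "m \<ge> 1"
  shows "odd_moment (2*m) n / 2 ^ (2*m) =
      ((-1)^n - 1) * t_bar1 ^ (2*m) / fact (2*m)
      + (-1)^m / 2^(2*m) * S_sum (ones_neg (2*m-1)) n
      + (\<Sum>u\<in>{0..m-1}. (-1)^u * T_sum (ones (2*u+1)) n / (fact (2*m-2*u-1) * 2^(2*u+1)) * A (2*m-2*u-1))
      + (\<Sum>v\<in>{0..m-1}. (-1)^v * t_bar1 ^ (2*m-2 * v-1) / (2^(2 * v+1) * fact (2*m-2 * v-1))
             * (T_sum (ones (2 * v+1)) n + T_sum (ones_neg (2 * v)) n))
      + (\<Sum>v\<in>{1..m-1}. (-1)^(v+1) * t_bar1 ^ (2*m-2 * v) / (2^(2 * v) * fact (2*m-2 * v))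
             * (S_sum (ones (2 * v)) n - S_sum (ones_neg (2 * v-1)) n))"
    (is "_ = ?B + ?E + ?a + ?b + ?c")
proof -
  let ?f = "\<lambda>k. odd_term (T_comb (2*m - k)) (S_comb (2*m - k)) k n / 2 ^ (2*m)"
  let ?c' = "\<lambda>v. (-1)^(v+1) * t_bar1 ^ (2*m-2 * v) / (2^(2 * v) * fact (2*m-2 * v))
             * (S_sum (ones (2 * v)) n - S_neg (2 * v) n)"
  have "(\<Sum>v\<in>{0..m-1}. ?f (2 * v)) = (\<Sum>v\<in>{0..m-1}. ?c' v)"
  proof (rule sum.cong[OF refl])
    fix v assume "v \<in> {0..m-1}"
    then have "2 * v \<le> 2 * m" by auto
    from S_comb_scaled[OF this, of "(-1) ^ v" n] show "?f (2 * v) = ?c' v"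
      by (simp add: odd_term_def)
  qed
  also have "\<dots> = ?c' 0 + (\<Sum>v\<in>{1..m-1}. ?c' v)"
    by (rule sum_split_0)
  also have "?c' 0 = ?B" by (simp add: S_neg_def field_simps)
  also have "(\<Sum>v\<in>{1..m-1}. ?c' v) = ?c"
    by (intro sum.cong refl) (simp add: S_neg_pos)
  finally have 1: "(\<Sum>v\<in>{0..m-1}. ?f (2 * v)) = ?B + ?c" .
  have "(\<Sum>v\<in>{0..m-1}. ?f (2 * v+1)) = (\<Sum>v\<in>{0..m-1}.
      (-1)^v * T_sum (ones (2 * v+1)) n / (fact (2*m-2 * v-1) * 2^(2 * v+1)) * A (2*m-2 * v-1)
      + (-1)^v * t_bar1 ^ (2*m-2 * v-1) / (2^(2 * v+1) * fact (2*m-2 * v-1))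
             * (T_sum (ones (2 * v+1)) n + T_sum (ones_neg (2 * v)) n))"
  proof (rule sum.cong[OF refl])
    fix v assume "v \<in> {0..m-1}"
    then have "2 * v + 1 \<le> 2 * m" using assms by auto
    from this T_comb_scaled[OF this, of "(-1) ^ v" n]
    show "?f (2 * v+1) = (-1)^v * T_sum (ones (2 * v+1)) n / (fact (2*m-2 * v-1) * 2^(2 * v+1)) * A (2*m-2 * v-1)
      + (-1)^v * t_bar1 ^ (2*m-2 * v-1) / (2^(2 * v+1) * fact (2*m-2 * v-1))
             * (T_sum (ones (2 * v+1)) n + T_sum (ones_neg (2 * v)) n)"
      by (simp add: odd_term_def T_neg_pos
          del: replicate_Suc power_Suc)
  qed
  also have "\<dots> = ?a + ?b"
    by (rule sum.distrib)
  finally have 2: "(\<Sum>v\<in>{0..m-1}. ?f (2 * v+1)) = ?a + ?b" .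
  have 3: "odd_term T_neg S_neg (2*m) n / 2 ^ (2*m) = ?E"
    using assms by (simp add: odd_term_def S_neg_pos)
  have "odd_moment (2*m) n / 2 ^ (2*m) = (\<Sum>k<2*m. ?f k) + odd_term T_neg S_neg (2*m) n / 2 ^ (2*m)"
    using assms by (simp add: moment_expansion add_divide_distrib sum_divide_distrib)
  then show ?thesis
    unfolding sum_lessThan_double[OF assms(2)] 1 2 3 by simp
qed

text \<open>At odd depth \<open>2 * v - 1\<close> the extra minus of \<open>odd_term\<close> turns
  \<open>(-1) ^ (v - 1)\<close> into \<open>(-1) ^ v\<close>, and likewise gives the final T-sum the
  sign \<open>(-1) ^ m\<close>.\<close>

lemma odd_moment_double_minus_one_scaled:
  assumes "n \<ge> 1" "m \<ge> 1"
  shows "odd_moment (2*m-1) n / 2 ^ (2*m-1) =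
      - ((-1)^n - 1) * t_bar1 ^ (2*m-1) / fact (2*m-1)
      + (-1)^m / 2^(2*m-1) * T_sum (ones_neg (2*m-2)) n
      - (\<Sum>u\<in>{1..m-1}. (-1)^u * T_sum (ones (2*u-1)) n / (fact (2*m-2*u) * 2^(2*u-1)) * A (2*m-2*u))
      + (\<Sum>v\<in>{1..m-1}. (-1)^v * t_bar1 ^ (2*m-2 * v) / (2^(2 * v-1) * fact (2*m-2 * v))
             * (T_sum (ones (2 * v-1)) n + T_sum (ones_neg (2 * v-2)) n))
      + (\<Sum>v\<in>{1..m-1}. (-1)^v * t_bar1 ^ (2*m-2 * v-1) / (2^(2 * v) * fact (2*m-2 * v-1))
             * (S_sum (ones (2 * v)) n - S_sum (ones_neg (2 * v-1)) n))"
    (is "_ = ?B + ?E - ?a + ?b + ?c")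
proof -
  let ?p = "2 * m - 1"
  let ?f = "\<lambda>k. odd_term (T_comb (?p - k)) (S_comb (?p - k)) k n / 2 ^ ?p"
  let ?c' = "\<lambda>v. (-1)^v * t_bar1 ^ (2*m-2 * v-1) / (2^(2 * v) * fact (2*m-2 * v-1))
             * (S_sum (ones (2 * v)) n - S_neg (2 * v) n)"
  have "(\<Sum>v\<in>{0..m-1}. ?f (2 * v)) = (\<Sum>v\<in>{0..m-1}. ?c' v)"
  proof (rule sum.cong[OF refl])
    fix v assume "v \<in> {0..m-1}"
    then have v: "2 * v \<le> ?p" "2 * v + 1 \<le> 2 * m" and eq: "?p - 2 * v = 2*m-2 * v-1"
      using assms by auto
    from v S_comb_scaled[OF v(1), of "(-1) ^ v" n] show "?f (2 * v) = ?c' v"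
      unfolding eq by (simp add: odd_term_def)
  qed
  also have "\<dots> = ?c' 0 + (\<Sum>v\<in>{1..m-1}. ?c' v)"
    by (rule sum_split_0)
  also have "?c' 0 = ?B" by (simp add: S_neg_def field_simps)
  also have "(\<Sum>v\<in>{1..m-1}. ?c' v) = ?c"
    by (intro sum.cong refl) (simp add: S_neg_pos)
  finally have 1: "(\<Sum>v\<in>{0..m-1}. ?f (2 * v)) = ?B + ?c" .
  have "(\<Sum>v\<in>{1..m-1}. ?f (2 * v-1)) = (\<Sum>v\<in>{1..m-1}.
      (-1)^v * t_bar1 ^ (2*m-2 * v) / (2^(2 * v-1) * fact (2*m-2 * v))
             * (T_sum (ones (2 * v-1)) n + T_sum (ones_neg (2 * v-2)) n)
      - (-1)^v * T_sum (ones (2 * v-1)) n / (fact (2*m-2 * v) * 2^(2 * v-1)) * A (2*m-2 * v))"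
  proof (rule sum.cong[OF refl])
    fix v assume "v \<in> {1..m-1}"
    then obtain w where w: "v = Suc w" "2 * w + 1 \<le> ?p" and eq: "?p - (2 * w + 1) = 2 * m - 2 * v"
      by (cases v) auto
    from w T_comb_scaled[OF w(2), of "(-1) ^ w" n]
    show "?f (2 * v-1) = (-1)^v * t_bar1 ^ (2*m-2 * v) / (2^(2 * v-1) * fact (2*m-2 * v))
             * (T_sum (ones (2 * v-1)) n + T_sum (ones_neg (2 * v-2)) n)
      - (-1)^v * T_sum (ones (2 * v-1)) n / (fact (2*m-2 * v) * 2^(2 * v-1)) * A (2*m-2 * v)"
      unfolding eq by (simp add: odd_term_def T_neg_pos eq[simplified w(1)]
          del: replicate_Suc)
  qed
  also have "\<dots> = ?b - ?a"
    by (rule sum_subtractf)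
  finally have 2: "(\<Sum>v\<in>{1..m-1}. ?f (2 * v-1)) = ?b - ?a" .
  obtain l where l: "m = Suc l" using assms by (cases m) auto
  have 3: "odd_term T_neg S_neg ?p n / 2 ^ ?p = ?E"
    by (simp add: l odd_term_def T_neg_pos)
  have "odd_moment ?p n / 2 ^ ?p = (\<Sum>k<?p. ?f k) + odd_term T_neg S_neg ?p n / 2 ^ ?p"
    using assms by (simp add: moment_expansion add_divide_distrib sum_divide_distrib)
  then show ?thesis
    unfolding sum_lessThan_double_minus_one[OF assms(2)] 1 2 3 by simp
qed

section \<open>Restoring the prefactors and assembling the integrals\<close>

lemma scale_boundary_term:
  fixes s F d :: real
  assumes "s * w = w'" "F \<noteq> 0"
  shows "s * F / d * (w * t / F) = w' / d * t"
  using assms by (simp add: field_simps)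

lemma scale_final_term:
  fixes F d :: real
  shows "(-1) ^ n * F / d * ((-1) ^ m / c * x) = (-1) ^ (n + m) * F / (c * d) * x"
  by (simp add: power_add mult_ac)

theorem theorem4p5:
  fixes n m :: nat
  assumes "n \<ge> 1" and "m \<ge> 1"
  shows
   "integral {0..1} (\<lambda>x::real. x ^ (2*n-2) * arctan x ^ (2*m)) =
        (1 + (-1)^n) / (2 * real n - 1) * t_bar1 ^ (2*m)
      + (-1)^(n+m) * fact (2*m) / (2^(2*m) * (2 * real n - 1)) * T_sum (ones_neg (2*m-1)) n
      - (-1)^n * fact (2*m) / (2 * real n - 1) *
          (\<Sum>u\<in>{0..m-1}. (-1)^u * T_sum (ones (2*u)) n / (fact (2*m-2*u) * 2^(2*u)) * A (2*m-2*u))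
      + (-1)^n * fact (2*m) / (2 * real n - 1) *
          (\<Sum>v\<in>{1..m-1}. (-1)^v * t_bar1 ^ (2*m-2 * v) / (2^(2 * v) * fact (2*m-2 * v))
             * (T_sum (ones (2 * v)) n + T_sum (ones_neg (2 * v-1)) n))
      + (-1)^n * fact (2*m) / (2 * real n - 1) *
          (\<Sum>v\<in>{0..m-1}. (-1)^v * t_bar1 ^ (2*m-2 * v-1) / (2^(2 * v+1) * fact (2*m-2 * v-1))
             * (S_sum (ones (2 * v+1)) n - S_sum (ones_neg (2 * v)) n))
  \<and> integral {0..1} (\<lambda>x::real. x ^ (2*n-2) * arctan x ^ (2*m-1)) =
      - (1 + (-1)^n) / (2 * real n - 1) * t_bar1 ^ (2*m-1)
      - (-1)^(n+m) * fact (2*m-1) / (2^(2*m-1) * (2 * real n - 1)) * S_sum (ones_neg (2*m-2)) n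
      - (-1)^n * fact (2*m-1) / (2 * real n - 1) *
          (\<Sum>u\<in>{0..m-1}. (-1)^u * T_sum (ones (2*u)) n / (fact (2*m-2*u-1) * 2^(2*u)) * A (2*m-2*u-1))
      + (-1)^n * fact (2*m-1) / (2 * real n - 1) *
          (\<Sum>v\<in>{1..m-1}. (-1)^(v+1) * t_bar1 ^ (2*m-2 * v-1) / (2^(2 * v) * fact (2*m-2 * v-1))
             * (T_sum (ones (2 * v)) n + T_sum (ones_neg (2 * v-1)) n))
      + (-1)^n * fact (2*m-1) / (2 * real n - 1) *
          (\<Sum>v\<in>{1..m-1}. (-1)^v * t_bar1 ^ (2*m-2 * v) / (2^(2 * v-1) * fact (2*m-2 * v))
             * (S_sum (ones (2 * v-1)) n - S_sum (ones_neg (2 * v-2)) n))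
  \<and> integral {0..1} (\<lambda>x::real. x ^ (2*n-1) * arctan x ^ (2*m)) =
        (1 - (-1)^n) / (2 * real n) * t_bar1 ^ (2*m)
      + (-1)^(n+m) * fact (2*m) / (2^(2*m) * (2 * real n)) * S_sum (ones_neg (2*m-1)) n
      + (-1)^n * fact (2*m) / (2 * real n) *
          (\<Sum>u\<in>{0..m-1}. (-1)^u * T_sum (ones (2*u+1)) n / (fact (2*m-2*u-1) * 2^(2*u+1)) * A (2*m-2*u-1))
      + (-1)^n * fact (2*m) / (2 * real n) *
          (\<Sum>v\<in>{0..m-1}. (-1)^v * t_bar1 ^ (2*m-2 * v-1) / (2^(2 * v+1) * fact (2*m-2 * v-1))
             * (T_sum (ones (2 * v+1)) n + T_sum (ones_neg (2 * v)) n))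
      + (-1)^n * fact (2*m) / (2 * real n) *
          (\<Sum>v\<in>{1..m-1}. (-1)^(v+1) * t_bar1 ^ (2*m-2 * v) / (2^(2 * v) * fact (2*m-2 * v))
             * (S_sum (ones (2 * v)) n - S_sum (ones_neg (2 * v-1)) n))
  \<and> integral {0..1} (\<lambda>x::real. x ^ (2*n-1) * arctan x ^ (2*m-1)) =
      - (1 - (-1)^n) / (2 * real n) * t_bar1 ^ (2*m-1)
      + (-1)^(n+m) * fact (2*m-1) / (2^(2*m-1) * (2 * real n)) * T_sum (ones_neg (2*m-2)) n
      - (-1)^n * fact (2*m-1) / (2 * real n) *
          (\<Sum>u\<in>{1..m-1}. (-1)^u * T_sum (ones (2*u-1)) n / (fact (2*m-2*u) * 2^(2*u-1)) * A (2*m-2*u))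
      + (-1)^n * fact (2*m-1) / (2 * real n) *
          (\<Sum>v\<in>{1..m-1}. (-1)^v * t_bar1 ^ (2*m-2 * v) / (2^(2 * v-1) * fact (2*m-2 * v))
             * (T_sum (ones (2 * v-1)) n + T_sum (ones_neg (2 * v-2)) n))
      + (-1)^n * fact (2*m-1) / (2 * real n) *
          (\<Sum>v\<in>{1..m-1}. (-1)^v * t_bar1 ^ (2*m-2 * v-1) / (2^(2 * v) * fact (2*m-2 * v-1))
             * (S_sum (ones (2 * v)) n - S_sum (ones_neg (2 * v-1)) n))"
proof -
  \<comment> \<open>Since \<open>(-1) ^ n\<close> squares to 1, the prefactor fixes
    \<open>1 + (-1) ^ n\<close> and negates \<open>(-1) ^ n - 1\<close>, which yields the boundary
    factors of the four formulas.\<close>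
  have sq: "(-1) ^ n * (1 + (-1) ^ n) = (1 + (-1) ^ n :: real)"
    "(-1) ^ n * - (1 + (-1) ^ n) = - (1 + (-1) ^ n :: real)"
    "(-1) ^ n * ((-1) ^ n - 1) = (1 - (-1) ^ n :: real)"
    "(-1) ^ n * - ((-1) ^ n - 1) = - (1 - (-1) ^ n :: real)"
    by (simp_all add: algebra_simps)
  \<comment> \<open>Fixing the left factor distributes the prefactor over the five summands without
    expanding products inside the sums.\<close>
  note expand = distrib_left[of "(-1) ^ n * fact _ / _"] right_diff_distrib[of "(-1) ^ n * fact _ / _"]
    scale_final_term
  have "arctan_moment (2*n-2) (2*m) = (-1) ^ n * fact (2*m) / (2 * real n - 1)
      * (even_moment (2*m) n / 2 ^ (2*m))"
    by (rule arctan_moment_even_eq[OF assms(1)])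
  note 1 = this[unfolded even_moment_double_scaled[OF assms] expand
      scale_boundary_term[OF sq(1) fact_nonzero], unfolded arctan_moment_def]
  have "arctan_moment (2*n-2) (2*m-1) = (-1) ^ n * fact (2*m-1) / (2 * real n - 1)
      * (even_moment (2*m-1) n / 2 ^ (2*m-1))"
    by (rule arctan_moment_even_eq[OF assms(1)])
  note 2 = this[unfolded even_moment_double_minus_one_scaled[OF assms] expand
      scale_boundary_term[OF sq(2) fact_nonzero], unfolded arctan_moment_def]
  have "arctan_moment (2*n-1) (2*m) = (-1) ^ n * fact (2*m) / (2 * real n)
      * (odd_moment (2*m) n / 2 ^ (2*m))"
    by (rule arctan_moment_odd_eq[OF assms(1)])
  note 3 = this[unfolded odd_moment_double_scaled[OF assms] expand
      scale_boundary_term[OF sq(3) fact_nonzero], unfolded arctan_moment_def]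
  have "arctan_moment (2*n-1) (2*m-1) = (-1) ^ n * fact (2*m-1) / (2 * real n)
      * (odd_moment (2*m-1) n / 2 ^ (2*m-1))"
    by (rule arctan_moment_odd_eq[OF assms(1)])
  note 4 = this[unfolded odd_moment_double_minus_one_scaled[OF assms] expand
      scale_boundary_term[OF sq(4) fact_nonzero], unfolded arctan_moment_def]
  show ?thesis
    using 1 2 3 4 by blast
qed

end
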